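(* Every $n$-vertex graph with $m$ edges, maximum degree at most $\frac{n}{3} + 1$, and no isolated vertices, has a bisection of size at least $\frac{m}{2} + \frac{n}{6}$.
   Context: Graphs are finite and simple. A bisection of a graph is a bipartition $V = V_1 \cup V_2$ of its vertex set into disjoint parts with $\big||V_1|-|V_2|\big| \le 1$; its size is the number $e(V_1,V_2)$ of edges with one endpoint in each part. *)

theory Defs
  imports Complex_Main
begin

text \<open>
  A finite simple graph is given by its vertex set and its set of edges, an edge being the
  two-element set of its endpoints. The graph without vertices is allowed.
\<close>

definition simple_graph :: "'a set \<Rightarrow> 'a set set \<Rightarrow> bool" where
  "simple_graph V E \<longleftrightarrow> finite V \<and> E \<subseteq> {e. e \<subseteq> V \<and> card e = 2}"

definition degree :: "'a set set \<Rightarrow> 'a \<Rightarrow> nat" where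
  "degree E v = card {e \<in> E. v \<in> e}"

definition isolated_vertex :: "'a set set \<Rightarrow> 'a \<Rightarrow> bool" where
  "isolated_vertex E v \<longleftrightarrow> degree E v = 0"

text \<open>
  Inserting 0 makes the maximum degree of the graph without vertices 0 (the maximum of the
  empty set is unspecified) and has no effect on other finite graphs.
\<close>

definition max_degree :: "'a set \<Rightarrow> 'a set set \<Rightarrow> nat" where
  "max_degree V E = Max (insert 0 (degree E ` V))"

definition bisection :: "'a set \<Rightarrow> 'a set \<Rightarrow> 'a set \<Rightarrow> bool" where
  "bisection V V\<^sub>1 V\<^sub>2 \<longleftrightarrow>
     V = V\<^sub>1 \<union> V\<^sub>2 \<and> V\<^sub>1 \<inter> V\<^sub>2 = {} \<and> \<bar>int (card V\<^sub>1) - int (card V\<^sub>2)\<bar> \<le> 1"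

definition edges_between :: "'a set set \<Rightarrow> 'a set \<Rightarrow> 'a set \<Rightarrow> nat" where
  "edges_between E V\<^sub>1 V\<^sub>2 = card {e \<in> E. \<exists>x\<in>V\<^sub>1. \<exists>y\<in>V\<^sub>2. e = {x, y}}"

end

theory Submission
  imports Defs
begin

text \<open>
  Take a maximum matching \<open>M\<close> and let \<open>W\<close> be the independent set of vertices it misses. Split every
  edge of \<open>M\<close> between the two sides, independently and uniformly at random: the edges of \<open>M\<close> are cut,
  every other edge inside \<open>\<Union>M\<close> is cut with probability 1/2. If \<open>w, w'\<close> in \<open>W\<close> are then put on opposite
  sides in the better of the two ways, the gain is half of the difference of their imbalances
  (neighbours on one side minus neighbours on the other). When some edge of \<open>M\<close> contributes
  differently to the two imbalances, that difference is at least 1 on average. So if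
  the vertices of \<open>W\<close> are grouped by the contributions of the edges of \<open>M\<close> to their imbalances, pairing
  off vertices of different groups until only a set \<open>U\<close> inside one group is left yields an excess
  of at least \<open>(n - card U) / 4\<close> over \<open>m / 2\<close>. Every group has at most \<open>n / 3\<close> vertices: in the group
  with all contributions zero the vertices form triangles with distinct edges of \<open>M\<close>, since
  there is no augmenting path; the vertices of another group share a neighbour, which has a
  further neighbour in \<open>M\<close>, and the degree bound applies.
\<close>

section \<open>Signs, splittings and labels\<close>

definition matching :: "'a set set \<Rightarrow> 'a set set \<Rightarrow> bool" where
  "matching E M \<longleftrightarrow> M \<subseteq> E \<and> pairwise disjnt M"

definition side :: "'a set \<Rightarrow> 'a \<Rightarrow> int" where
  "side B x = (if x \<in> B then 1 else - 1)"

text \<open>For a two-element set this is 1 if \<open>B\<close> separates its elements and -1 otherwise.\<close>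

definition cut_sign :: "'a set \<Rightarrow> 'a set \<Rightarrow> int" where
  "cut_sign B e = - (\<Prod>x\<in>e. side B x)"

definition adj :: "'a set set \<Rightarrow> 'a \<Rightarrow> 'a \<Rightarrow> int" where
  "adj E x y = of_bool ({x, y} \<in> E)"

text \<open>The transversals encode the random splittings of the edges of \<open>M\<close>.\<close>

definition transversals :: "'a set set \<Rightarrow> 'a set set" where
  "transversals M = {C. C \<subseteq> \<Union>M \<and> (\<forall>e\<in>M. card (C \<inter> e) = 1)}"

text \<open>Symmetric difference. For an edge \<open>e\<close> of a matching \<open>M\<close> it
  reverses the splitting of \<open>e\<close> and of no other edge of \<open>M\<close>.\<close>

definition flip :: "'a set \<Rightarrow> 'a set \<Rightarrow> 'a set" where
  "flip e C = (C - e) \<union> (e - C)"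

text \<open>For a transversal \<open>C\<close>, the edge \<open>{u, v}\<close> of \<open>M\<close>
  contributes \<open>side C u * label E M w u v\<close> to the imbalance of \<open>w\<close>.
  Ordered pairs fix the sign, and the value 0 off \<open>M\<close> lets all contributions be
  compared by one equation between functions.\<close>

definition label :: "'a set set \<Rightarrow> 'a set set \<Rightarrow> 'a \<Rightarrow> 'a \<Rightarrow> 'a \<Rightarrow> int" where
  "label E M w = (\<lambda>u v. if {u, v} \<in> M then adj E w u - adj E w v else 0)"

definition imbalance :: "'a set set \<Rightarrow> 'a set \<Rightarrow> 'a set \<Rightarrow> 'a \<Rightarrow> int" where
  "imbalance E A C w = (\<Sum>x\<in>A. adj E w x * side C x)"

section \<open>Flips, edges and matchings\<close>

lemma side_flip: "side (flip e C) x = (if x \<in> e then - side C x else side C x)"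
  by (auto simp: side_def flip_def)

lemma flip_flip: "flip e (flip e C) = C"
  by (auto simp: flip_def)

lemma simple_graph_edge:
  assumes "simple_graph V E" "e \<in> E"
  obtains x y where "e = {x, y}" "x \<noteq> y" "x \<in> V" "y \<in> V"
  using assms by (force simp: simple_graph_def card_2_iff)

lemma simple_graph_finite:
  assumes "simple_graph V E"
  shows "finite V" "finite E"
proof -
  show "finite V" using assms by (simp add: simple_graph_def)
  moreover have "E \<subseteq> Pow V" using assms by (auto simp: simple_graph_def)
  ultimately show "finite E" by (meson finite_Pow_iff finite_subset)
qed

lemma simple_graph_edge_at:
  assumes "simple_graph V E" "e \<in> E" "x \<in> e"
  obtains y where "e = {x, y}" "y \<in> V" "y \<noteq> x"
proof -
  obtain a b where ab: "e = {a, b}" "a \<noteq> b" "a \<in> V" "b \<in> V"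
    by (rule simple_graph_edge[OF assms(1,2)])
  then consider "x = a" | "x = b" using assms(3) by blast
  then show ?thesis by cases (use that[of b] that[of a] ab in \<open>auto simp: insert_commute\<close>)
qed

lemma simple_graph_finite_edge:
  assumes "simple_graph V E" "e \<in> E"
  shows "finite e"
  using simple_graph_edge[OF assms] by blast

lemma simple_graph_subset:
  assumes "simple_graph V E" "matching E M"
  shows "simple_graph V M"
  using assms by (auto simp: simple_graph_def matching_def)

lemma matching_finite:
  assumes "simple_graph V E" "matching E M"
  shows "finite M"
  using assms(2) simple_graph_finite(2)[OF assms(1)] unfolding matching_def by (meson finite_subset)

lemma card_Union_matching:
  assumes "simple_graph V E" "matching E M"
  shows "card (\<Union>M) = 2 * card M"
proof -
  have M: "simple_graph V M" by (rule simple_graph_subset[OF assms])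
  have "card (\<Union>M) = (\<Sum>e\<in>M. card e)"
    using assms(2) simple_graph_finite_edge[OF M]
    by (intro card_Union_disjoint) (auto simp: matching_def)
  also have "\<dots> = (\<Sum>e\<in>M. 2)"
    using M by (intro sum.cong) (auto simp: simple_graph_def)
  finally show ?thesis by simp
qed

lemma matching_edge_unique:
  assumes "matching E M" "e \<in> M" "f \<in> M" "x \<in> e" "x \<in> f"
  shows "e = f"
  using assms by (auto simp: matching_def pairwise_def disjnt_def)

section \<open>Averages over transversals\<close>

lemma transversals_nonempty:
  assumes "simple_graph V E" "matching E M"
  shows "transversals M \<noteq> {}"
proof -
  have "\<exists>x. x \<in> e" if "e \<in> M" for e
    using simple_graph_edge[OF simple_graph_subset[OF assms] that] by blast
  then obtain c where c: "\<And>e. e \<in> M \<Longrightarrow> c e \<in> e" by metis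
  have "c ` M \<inter> e = {c e}" if "e \<in> M" for e
    using c that matching_edge_unique[OF assms(2)] by blast
  then have "c ` M \<in> transversals M"
    using c by (auto simp: transversals_def)
  then show ?thesis by blast
qed

lemma transversals_finite:
  assumes "simple_graph V E" "matching E M"
  shows "finite (transversals M)"
proof -
  have "simple_graph V M" by (rule simple_graph_subset[OF assms])
  then have "\<Union>M \<subseteq> V" "finite V" by (auto simp: simple_graph_def)
  then have "finite (Pow (\<Union>M))" by (meson finite_Pow_iff finite_subset)
  then show ?thesis by (rule rev_finite_subset) (auto simp: transversals_def)
qed

lemma flip_transversals:
  assumes "simple_graph V E" "matching E M" "e \<in> M" "C \<in> transversals M"
  shows "flip e C \<in> transversals M"
proof -
  have "card (flip e C \<inter> f) = 1" if f: "f \<in> M" for f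
  proof (cases "f = e")
    case True
    have "card e = 2" "card (C \<inter> e) = 1" "finite e"
      using simple_graph_subset[OF assms(1,2)] assms(3,4)
      by (auto simp: simple_graph_def transversals_def card_ge_0_finite)
    moreover have "flip e C \<inter> f = e - C \<inter> e" using True by (auto simp: flip_def)
    ultimately show ?thesis by (simp add: card_Diff_subset)
  next
    case False
    then have "flip e C \<inter> f = C \<inter> f"
      using matching_edge_unique[OF assms(2) assms(3) f] by (auto simp: flip_def)
    then show ?thesis using assms(4) f by (simp add: transversals_def)
  qed
  moreover have "flip e C \<subseteq> \<Union>M"
    using assms(3,4) by (auto simp: flip_def transversals_def)
  ultimately show ?thesis by (simp add: transversals_def)
qed

text \<open>\<open>flip e\<close> is an involution on the transversals. This invariance stands in
  for the uniform and independent random splittings.\<close>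

lemma sum_flip:
  assumes "simple_graph V E" "matching E M" "e \<in> M"
  shows "(\<Sum>C\<in>transversals M. g (flip e C)) = (\<Sum>C\<in>transversals M. g C)"
  by (rule sum.reindex_bij_witness[of _ "flip e" "flip e"])
    (use flip_transversals[OF assms] in \<open>auto simp: flip_flip\<close>)

lemma transversal_side:
  assumes "C \<in> transversals M" "{u, v} \<in> M" "u \<noteq> v"
  shows "side C v = - side C u"
proof -
  have "card (C \<inter> {u, v}) = 1" using assms by (simp add: transversals_def)
  then show ?thesis using assms(3)
    by (cases "u \<in> C"; cases "v \<in> C") (simp_all add: side_def Int_insert_right)
qed

lemma transversal_balanced:
  assumes "simple_graph V E" "matching E M" "C \<in> transversals M"
  shows "(\<Sum>x\<in>\<Union>M. side C x) = 0"
proof -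
  have M: "simple_graph V M" by (rule simple_graph_subset[OF assms(1,2)])
  have "(\<Sum>x\<in>\<Union>M. side C x) = (\<Sum>e\<in>M. \<Sum>x\<in>e. side C x)"
    using assms(2) simple_graph_finite_edge[OF M]
    by (subst sum.Union_disjoint) (auto simp: matching_def pairwise_def disjnt_def)
  also have "\<dots> = (\<Sum>e\<in>M. 0)"
  proof (rule sum.cong)
    fix e assume e: "e \<in> M"
    then obtain x y where xy: "e = {x, y}" "x \<noteq> y" by (rule simple_graph_edge[OF M])
    have "side C y = - side C x" using transversal_side[OF assms(3)] e xy by blast
    then show "(\<Sum>x\<in>e. side C x) = 0" using xy by simp
  qed simp
  finally show ?thesis by simp
qed

text \<open>Every transversal separates the ends of an edge of \<open>M\<close>. For any other edge,
  flipping the edge of \<open>M\<close> through one end leaves the other end in place and reverses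
  the sign, so the terms cancel.\<close>

lemma sum_cut_sign_transversals:
  assumes G: "simple_graph V E" and M: "matching E M" and e: "e \<in> E" "e \<subseteq> \<Union>M"
  shows "(\<Sum>C\<in>transversals M. cut_sign C e)
    = (if e \<in> M then int (card (transversals M)) else 0)"
proof -
  obtain x y where xy: "e = {x, y}" "x \<noteq> y" by (rule simple_graph_edge[OF G e(1)])
  have sgn: "cut_sign C e = - (side C x * side C y)" for C
    using xy by (simp add: cut_sign_def)
  show ?thesis
  proof (cases "e \<in> M")
    case True
    have "cut_sign C e = 1" if "C \<in> transversals M" for C
    proof -
      have "side C y = - side C x" using transversal_side[OF that] True xy by blast
      then show ?thesis by (simp add: sgn side_def)
    qed
    then show ?thesis using True by simp
  next
    case False
    obtain f where f: "f \<in> M" "x \<in> f" using e xy by blast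
    have "y \<notin> f"
    proof
      assume "y \<in> f"
      moreover obtain a b where "f = {a, b}" by (rule simple_graph_edge[OF simple_graph_subset[OF G M] f(1)])
      ultimately have "f = e" using f(2) xy by auto
      then show False using f(1) False by simp
    qed
    then have "cut_sign (flip f C) e = - cut_sign C e" for C
      using f(2) by (simp add: sgn side_flip)
    then have "(\<Sum>C\<in>transversals M. cut_sign C e) = - (\<Sum>C\<in>transversals M. cut_sign C e)"
      using sum_flip[OF G M f(1), of "\<lambda>C. cut_sign C e"] by (simp add: sum_negf)
    then show ?thesis using False by simp
  qed
qed

text \<open>Only \<open>u\<close> and \<open>v\<close> change sides, and their signs are opposite,
  so the two changes combine into a difference of adjacencies.\<close>

lemma imbalance_flip:
  assumes G: "simple_graph V E" and M: "matching E M" and C: "C \<in> transversals M"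
    and uv: "{u, v} \<in> M" "u \<noteq> v"
  shows "imbalance E (\<Union>M) C w - imbalance E (\<Union>M) (flip {u, v} C) w
    = 2 * side C u * label E M w u v"
proof -
  have "\<Union>M \<subseteq> V" using simple_graph_subset[OF G M] by (auto simp: simple_graph_def)
  then have fin: "finite (\<Union>M)" using simple_graph_finite(1)[OF G] by (rule finite_subset)
  have "imbalance E (\<Union>M) C w - imbalance E (\<Union>M) (flip {u, v} C) w
      = (\<Sum>x\<in>\<Union>M. adj E w x * (side C x - side (flip {u, v} C) x))"
    by (simp only: imbalance_def sum_subtractf right_diff_distrib)
  also have "\<dots> = (\<Sum>x\<in>{u, v}. adj E w x * (2 * side C x))"
  proof (rule sum.mono_neutral_cong_right[OF fin])
    show "{u, v} \<subseteq> \<Union>M" using uv by blast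
  qed (simp_all add: side_flip)
  also have "\<dots> = adj E w u * (2 * side C u) + adj E w v * (2 * side C v)"
    using uv(2) by simp
  also have "\<dots> = 2 * side C u * (adj E w u - adj E w v)"
    unfolding transversal_side[OF C uv] by (simp add: algebra_simps)
  finally show ?thesis using uv(1) by (simp add: label_def)
qed

text \<open>Each \<open>C\<close> is compared with its flip at an edge of \<open>M\<close> where the
  labels differ; the two absolute values together are at least 2.\<close>

lemma sum_imbalance_diff:
  assumes G: "simple_graph V E" and M: "matching E M"
    and neq: "label E M w \<noteq> label E M w'"
  shows "int (card (transversals M))
    \<le> (\<Sum>C\<in>transversals M. \<bar>imbalance E (\<Union>M) C w - imbalance E (\<Union>M) C w'\<bar>)"
proof -
  obtain u v where uv: "label E M w u v \<noteq> label E M w' u v"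
    using neq by (meson ext)
  then have e: "{u, v} \<in> M" "u \<noteq> v" by (auto simp: label_def split: if_splits)
  define Z where "Z C = imbalance E (\<Union>M) C w - imbalance E (\<Union>M) C w'" for C
  have "2 \<le> \<bar>Z C\<bar> + \<bar>Z (flip {u, v} C)\<bar>" if "C \<in> transversals M" for C
  proof -
    have "Z C - Z (flip {u, v} C) = 2 * side C u * (label E M w u v - label E M w' u v)"
      using imbalance_flip[OF G M that e, of w] imbalance_flip[OF G M that e, of w']
      by (simp add: Z_def algebra_simps)
    \<comment> \<open>The difference is twice a nonzero integer up to sign, so the triangle
      inequality applies.\<close>
    then show ?thesis using uv by (auto simp: side_def split: if_splits)
  qed
  then have "(\<Sum>C\<in>transversals M. 2) \<le> (\<Sum>C\<in>transversals M. \<bar>Z C\<bar> + \<bar>Z (flip {u, v} C)\<bar>)"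
    by (intro sum_mono)
  also have "\<dots> = 2 * (\<Sum>C\<in>transversals M. \<bar>Z C\<bar>)"
    using sum_flip[OF G M e(1), of "\<lambda>C. \<bar>Z C\<bar>"] by (simp add: sum.distrib)
  finally show ?thesis by (simp add: Z_def)
qed

section \<open>Cut size as a sum of signs\<close>

text \<open>The sum is twice the excess of the cut over half of the edges, so the theorem needs it
  to be at least \<open>n / 3\<close>.\<close>

lemma sum_cut_sign:
  assumes G: "simple_graph V E" and B: "B \<subseteq> V"
  shows "(\<Sum>e\<in>E. cut_sign B e) = 2 * int (edges_between E B (V - B)) - int (card E)"
proof -
  let ?K = "{e \<in> E. \<exists>x\<in>B. \<exists>y\<in>V - B. e = {x, y}}"
  have "cut_sign B e = 2 * of_bool (e \<in> ?K) - 1" if "e \<in> E" for e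
  proof -
    obtain x y where "e = {x, y}" "x \<noteq> y" "x \<in> V" "y \<in> V"
      by (rule simple_graph_edge[OF G \<open>e \<in> E\<close>])
    then show ?thesis using \<open>e \<in> E\<close> B
      by (auto simp: cut_sign_def side_def doubleton_eq_iff)
  qed
  then have "(\<Sum>e\<in>E. cut_sign B e) = (\<Sum>e\<in>E. 2 * of_bool (e \<in> ?K) - 1)" by simp
  also have "\<dots> = 2 * (\<Sum>e\<in>E. of_bool (e \<in> ?K)) - int (card E)"
    by (simp only: sum_subtractf sum_distrib_left) simp
  also have "(\<Sum>e\<in>E. of_bool (e \<in> ?K)) = int (card ?K)"
    using simple_graph_finite(2)[OF G] by (simp add: sum_of_bool_eq Int_def)
  finally show ?thesis by (simp add: edges_between_def)
qed

text \<open>As \<open>V - A\<close> is independent, an edge not inside \<open>A\<close> has exactly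
  one end outside \<open>A\<close>; these edges are grouped by that end.\<close>

lemma sum_cut_sign_split:
  assumes G: "simple_graph V E" and A: "A \<subseteq> V"
    and indep: "\<And>e. e \<in> E \<Longrightarrow> \<not> e \<subseteq> V - A"
  shows "(\<Sum>e\<in>E. cut_sign B e) = (\<Sum>e\<in>{e \<in> E. e \<subseteq> A}. cut_sign B e)
    - (\<Sum>w\<in>V - A. side B w * imbalance E A B w)"
proof -
  have fin: "finite V" "finite E" "finite A"
    using simple_graph_finite[OF G] A by (auto intro: finite_subset)
  let ?X = "{e \<in> E. \<not> e \<subseteq> A}" and ?N = "{(w, x) \<in> (V - A) \<times> A. {w, x} \<in> E}"
  have bij: "bij_betw (\<lambda>(w, x). {w, x}) ?N ?X"
  proof (rule bij_betw_imageI)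
    show "inj_on (\<lambda>(w, x). {w, x}) ?N" by (auto simp: inj_on_def doubleton_eq_iff)
    show "(\<lambda>(w, x). {w, x}) ` ?N = ?X"
    proof
      show "?X \<subseteq> (\<lambda>(w, x). {w, x}) ` ?N"
      proof
        fix e assume e: "e \<in> ?X"
        then have "e \<in> E" by simp
        then obtain x y where xy: "e = {x, y}" "x \<in> V" "y \<in> V"
          by (rule simple_graph_edge[OF G])
        then consider "x \<in> V - A" "y \<in> A" | "y \<in> V - A" "x \<in> A"
          using e indep[of e] by auto
        then show "e \<in> (\<lambda>(w, x). {w, x}) ` ?N"
        proof cases
          case 1
          then show ?thesis using e xy by (intro image_eqI[of _ _ "(x, y)"]) auto
        next
          case 2
          then show ?thesis using e xy
            by (intro image_eqI[of _ _ "(y, x)"]) (auto simp: insert_commute)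
        qed
      qed
    qed auto
  qed
  have pair: "cut_sign B {w, x} = - (side B w * side B x)" if "w \<notin> A" "x \<in> A" for w x
  proof -
    have "w \<noteq> x" using that by blast
    then show ?thesis by (simp add: cut_sign_def)
  qed
  have "(\<Sum>e\<in>?X. cut_sign B e) = (\<Sum>(w, x)\<in>?N. cut_sign B {w, x})"
    using sum.reindex_bij_betw[OF bij, of "cut_sign B"] by (simp add: case_prod_unfold)
  \<comment> \<open>Non-adjacent pairs contribute 0 through \<open>adj\<close>, so the sum may run
    over the whole product.\<close>
  also have "\<dots> = (\<Sum>(w, x)\<in>(V - A) \<times> A. - (side B w * (adj E w x * side B x)))"
    using fin by (intro sum.mono_neutral_cong_left) (auto simp: adj_def pair)
  also have "\<dots> = - (\<Sum>w\<in>V - A. side B w * imbalance E A B w)"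
    by (simp add: sum.cartesian_product[symmetric] imbalance_def sum_distrib_left sum_negf)
  finally have X: "(\<Sum>e\<in>?X. cut_sign B e) = - (\<Sum>w\<in>V - A. side B w * imbalance E A B w)" .
  have "E = {e \<in> E. e \<subseteq> A} \<union> ?X" by blast
  then have "(\<Sum>e\<in>E. cut_sign B e) = (\<Sum>e\<in>{e \<in> E. e \<subseteq> A}. cut_sign B e) + (\<Sum>e\<in>?X. cut_sign B e)"
    using fin by (subst sum.union_disjoint[symmetric]) auto
  then show ?thesis using X by simp
qed

section \<open>Pairing off the unmatched vertices\<close>

text \<open>Two elements with different values of \<open>c\<close> are removed as long as there are
  any; \<open>j\<close> sends one member of each pair to the other, and \<open>U\<close> is what
  remains.\<close>

lemma distinct_label_pairing:
  fixes c :: "'a \<Rightarrow> 'b"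
  assumes "finite W"
  shows "\<exists>I j U. W = I \<union> j ` I \<union> U \<and> inj_on j I \<and> I \<inter> j ` I = {} \<and> (I \<union> j ` I) \<inter> U = {} \<and>
    (\<forall>w\<in>I. c w \<noteq> c (j w)) \<and> (\<forall>x\<in>U. \<forall>y\<in>U. c x = c y)"
  using assms
proof (induction W rule: finite_psubset_induct)
  case (psubset W)
  show ?case
  proof (cases "\<forall>x\<in>W. \<forall>y\<in>W. c x = c y")
    case True
    show ?thesis
    proof (intro exI conjI)
      show "W = {} \<union> id ` {} \<union> W" by simp
      show "\<forall>x\<in>W. \<forall>y\<in>W. c x = c y" by (rule True)
    qed simp_all
  next
    case False
    then obtain x y where xy: "x \<in> W" "y \<in> W" "c x \<noteq> c y" by blast
    then have "W - {x, y} \<subset> W" by blast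
    obtain I j U where
      IH: "W - {x, y} = I \<union> j ` I \<union> U" "inj_on j I" "I \<inter> j ` I = {}" "(I \<union> j ` I) \<inter> U = {}"
        "\<forall>w\<in>I. c w \<noteq> c (j w)" "\<forall>x\<in>U. \<forall>y\<in>U. c x = c y"
      using psubset.IH[OF \<open>W - {x, y} \<subset> W\<close>] by (elim exE conjE) (rule that)
    have notin: "x \<notin> I" "y \<notin> I" "x \<notin> j ` I" "y \<notin> j ` I" "x \<notin> U" "y \<notin> U" "x \<noteq> y"
      using IH(1) xy by auto
    have img: "j(x := y) ` insert x I = insert y (j ` I)" using notin by auto
    show ?thesis
    proof (intro exI conjI)
      show "W = insert x I \<union> j(x := y) ` insert x I \<union> U" unfolding img using IH(1) xy by blast
      show "inj_on (j(x := y)) (insert x I)" using IH(2) notin by (auto simp: inj_on_def)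
      show "insert x I \<inter> j(x := y) ` insert x I = {}" unfolding img using IH(3) notin by blast
      show "(insert x I \<union> j(x := y) ` insert x I) \<inter> U = {}" unfolding img using IH(4) notin by blast
      show "\<forall>w\<in>insert x I. c w \<noteq> c ((j(x := y)) w)" using IH(5) xy notin by auto
      show "\<forall>x\<in>U. \<forall>y\<in>U. c x = c y" by (rule IH(6))
    qed
  qed
qed

text \<open>Any halving works up to exchanging the halves: passing from \<open>B\<close> to
  \<open>U - B\<close> negates both sums.\<close>

lemma balanced_nonpos:
  fixes X :: "'a \<Rightarrow> int"
  assumes "finite U"
  shows "\<exists>B\<subseteq>U. \<bar>\<Sum>w\<in>U. side B w\<bar> \<le> 1 \<and> (\<Sum>w\<in>U. side B w * X w) \<le> 0"
proof -
  \<comment> \<open>Rounding down makes the sum of the signs 0 or -1.\<close>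
  obtain B where B: "B \<subseteq> U" "card B = card U div 2"
    using obtain_subset_with_card_n[of "card U div 2" U] by auto
  have "(\<Sum>w\<in>U. side B w) = (\<Sum>w\<in>U. 2 * of_bool (w \<in> B) - 1)"
    by (intro sum.cong) (auto simp: side_def)
  also have "\<dots> = 2 * (\<Sum>w\<in>U. of_bool (w \<in> B)) - int (card U)"
    by (simp only: sum_subtractf sum_distrib_left) simp
  also have "(\<Sum>w\<in>U. of_bool (w \<in> B)) = int (card B)"
    using assms B(1) by (simp add: sum_of_bool_eq Int_absorb1)
  finally have bal: "\<bar>\<Sum>w\<in>U. side B w\<bar> \<le> 1" using B(2) by linarith
  have neg: "side (U - B) w = - side B w" if "w \<in> U" for w using that by (simp add: side_def)
  show ?thesis
  proof (cases "(\<Sum>w\<in>U. side B w * X w) \<le> 0")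
    case True
    then show ?thesis using B bal by blast
  next
    case False
    then show ?thesis using bal
      by (intro exI[of _ "U - B"]) (auto simp: neg sum_negf)
  qed
qed

text \<open>A split pair has total sign 0, so \<open>U\<close> alone decides the balance, and each
  pair can be oriented in the better of the two ways.\<close>

lemma balanced_pairing:
  fixes X :: "'a \<Rightarrow> int"
  assumes "finite W" "W = I \<union> j ` I \<union> U" "inj_on j I" "I \<inter> j ` I = {}" "(I \<union> j ` I) \<inter> U = {}"
  shows "\<exists>B\<subseteq>W. \<bar>\<Sum>w\<in>W. side B w\<bar> \<le> 1 \<and>
    (\<Sum>w\<in>I. \<bar>X w - X (j w)\<bar>) \<le> - (\<Sum>w\<in>W. side B w * X w)"
proof -
  have fin: "finite I" "finite U" using assms by auto
  obtain D where D: "D \<subseteq> U" "\<bar>\<Sum>w\<in>U. side D w\<bar> \<le> 1" "(\<Sum>w\<in>U. side D w * X w) \<le> 0"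
    using balanced_nonpos[OF fin(2)] by blast
  \<comment> \<open>In each pair the member with the smaller \<open>X\<close> gets sign 1, so the
    pair contributes \<open>- \<bar>X w - X (j w)\<bar>\<close>.\<close>
  define B where "B = {w \<in> I. X w \<le> X (j w)} \<union> j ` {w \<in> I. X w > X (j w)} \<union> D"
  have BI: "side B w = (if X w \<le> X (j w) then 1 else - 1)" if "w \<in> I" for w
    using that assms D(1) unfolding B_def side_def by auto
  have BJ: "side B (j w) = (if X w \<le> X (j w) then - 1 else 1)" if "w \<in> I" for w
    using that assms D(1) unfolding B_def side_def by (auto dest: inj_onD)
  have BU: "side B w = side D w" if "w \<in> U" for w
    using that assms D(1) unfolding B_def side_def by auto
  have split: "(\<Sum>w\<in>W. g w) = (\<Sum>w\<in>I. g w + g (j w)) + (\<Sum>w\<in>U. g w)" for g :: "'a \<Rightarrow> int"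
  proof -
    have "(\<Sum>w\<in>W. g w) = (\<Sum>w\<in>I. g w) + (\<Sum>w\<in>j ` I. g w) + (\<Sum>w\<in>U. g w)"
      unfolding assms(2) using fin assms(4,5)
      by (subst sum.union_disjoint, simp, simp, simp, subst sum.union_disjoint) auto
    then show ?thesis using assms(3) by (simp add: sum.reindex sum.distrib)
  qed
  have "(\<Sum>w\<in>W. side B w) = (\<Sum>w\<in>U. side D w)"
    unfolding split by (simp add: BI BJ BU sum.neutral)
  moreover have "(\<Sum>w\<in>W. side B w * X w) = (\<Sum>w\<in>I. - \<bar>X w - X (j w)\<bar>) + (\<Sum>w\<in>U. side D w * X w)"
    unfolding split by (intro arg_cong2[where f = plus] sum.cong) (auto simp: BI BJ BU)
  ultimately show ?thesis using D
    by (intro exI[of _ B]) (auto simp: sum_negf B_def assms(2))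
qed

section \<open>Maximum matchings and label classes\<close>

lemma maximum_matching_exists:
  assumes "simple_graph V E"
  shows "\<exists>M. matching E M \<and> (\<forall>N. matching E N \<longrightarrow> card N \<le> card M)"
proof -
  have "matching E {}" by (simp add: matching_def)
  moreover have "\<forall>N. matching E N \<longrightarrow> card N < Suc (card E)"
    using simple_graph_finite(2)[OF assms] by (simp add: matching_def card_mono less_Suc_eq_le)
  ultimately show ?thesis
    using ex_has_greatest_nat[of "matching E" "{}" card "Suc (card E)"] by blast
qed

lemma maximum_matching_independent:
  assumes G: "simple_graph V E" and M: "matching E M"
    and max: "\<And>N. matching E N \<Longrightarrow> card N \<le> card M"
    and e: "e \<in> E"
  shows "\<not> e \<subseteq> V - \<Union>M"
proof
  assume "e \<subseteq> V - \<Union>M"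
  moreover have "e \<noteq> {}" using simple_graph_edge[OF G e] by blast
  ultimately have "e \<notin> M" "matching E (insert e M)"
    using M e by (auto simp: matching_def pairwise_insert disjnt_def)
  moreover have "finite M"
    by (rule matching_finite[OF G M])
  ultimately show False using max[of "insert e M"] by simp
qed

text \<open>Replacing \<open>{x, y}\<close> by \<open>{w, x}\<close> and \<open>{w', y}\<close>
  would enlarge \<open>M\<close>.\<close>

lemma maximum_matching_no_augmentation:
  assumes G: "simple_graph V E" and M: "matching E M"
    and max: "\<And>N. matching E N \<Longrightarrow> card N \<le> card M"
    and xy: "{x, y} \<in> M" and w: "w \<notin> \<Union>M" "w' \<notin> \<Union>M" "w \<noteq> w'"
    and E: "{w, x} \<in> E" "{w', y} \<in> E"
  shows False
proof -
  let ?R = "M - {{x, y}}"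
  have fin: "finite M"
    by (rule matching_finite[OF G M])
  have "x \<noteq> y" using xy M G by (auto simp: matching_def simple_graph_def)
  have "x \<notin> \<Union>?R" "y \<notin> \<Union>?R" using matching_edge_unique[OF M xy] by blast+
  then have disj: "disjnt {w, x} e" "disjnt {w', y} e" if "e \<in> ?R" for e
    using that w unfolding disjnt_def by blast+
  have xyw: "x \<noteq> w'" "y \<noteq> w" using xy w by blast+
  have ne: "{w, x} \<notin> ?R" "{w', y} \<notin> ?R" "{w, x} \<noteq> {w', y}"
    using w xyw by (auto simp: doubleton_eq_iff)
  have "pairwise disjnt (insert {w, x} (insert {w', y} ?R))"
    using M disj w xyw \<open>x \<noteq> y\<close>
    by (auto simp: matching_def pairwise_insert disjnt_sym pairwise_def)
  then have "matching E (insert {w, x} (insert {w', y} ?R))"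
    using M E by (auto simp: matching_def)
  from max[OF this] have "Suc (Suc (card ?R)) \<le> card M"
    using ne fin by simp
  moreover have "card M = Suc (card ?R)" using xy fin by (metis card.remove)
  ultimately show False by simp
qed

lemma label_class_bound:
  assumes G: "simple_graph V E" and M: "matching E M"
    and max: "\<And>N. matching E N \<Longrightarrow> card N \<le> card M"
    and deg: "\<And>v. v \<in> V \<Longrightarrow> 3 * degree E v \<le> card V + 3"
    and pos: "\<And>v. v \<in> V \<Longrightarrow> degree E v \<noteq> 0"
    and U: "U \<subseteq> V - \<Union>M" and same: "\<And>w w'. w \<in> U \<Longrightarrow> w' \<in> U \<Longrightarrow> label E M w = label E M w'"
  shows "3 * card U \<le> card V"
proof (cases "\<forall>w\<in>U. \<forall>u v. label E M w u v = 0")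
  case True
  have fin: "finite V" "finite E" "finite M"
    using simple_graph_finite[OF G] matching_finite[OF G M] by auto
  \<comment> \<open>A neighbour of \<open>w\<close> exists since \<open>w\<close> is not isolated,
    and it is covered by \<open>M\<close> since \<open>e\<close> cannot avoid
    \<open>\<Union>M\<close>. The zero label makes \<open>w\<close> adjacent to its partner as
    well.\<close>
  have "\<exists>x y. {x, y} \<in> M \<and> {w, x} \<in> E \<and> {w, y} \<in> E" if w: "w \<in> U" for w
  proof -
    have "degree E w \<noteq> 0" using pos w U by blast
    then have "{e \<in> E. w \<in> e} \<noteq> {}" unfolding degree_def by (metis card.empty)
    then obtain e where e: "e \<in> E" "w \<in> e" by blast
    then obtain x where x: "e = {w, x}" "x \<in> V" by (rule simple_graph_edge_at[OF G])
    then have "x \<in> \<Union>M"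
      using maximum_matching_independent[OF G M max e(1)] w U by blast
    then obtain f where f: "f \<in> M" "x \<in> f" by blast
    obtain y where y: "f = {x, y}" by (rule simple_graph_edge_at[OF simple_graph_subset[OF G M] f])
    have "label E M w x y = 0" using True w by blast
    then have "{w, y} \<in> E" using e(1) x f y by (auto simp: label_def adj_def split: if_splits)
    then show ?thesis using e(1) x f y by blast
  qed
  then obtain p q where pq: "\<And>w. w \<in> U \<Longrightarrow> {p w, q w} \<in> M \<and> {w, p w} \<in> E \<and> {w, q w} \<in> E"
    by metis
  \<comment> \<open>Two vertices sharing an edge of \<open>M\<close> would both be adjacent to both
    of its ends, giving an augmenting path.\<close>
  have "inj_on (\<lambda>w. {p w, q w}) U"
  proof (rule inj_onI, rule ccontr)
    fix w w' assume w: "w \<in> U" "w' \<in> U" "{p w, q w} = {p w', q w'}" "w \<noteq> w'"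
    then have "{w', q w} \<in> E" using pq[OF w(2)] by (auto simp: doubleton_eq_iff)
    then show False
      using maximum_matching_no_augmentation[OF G M max, of "p w" "q w" w w'] pq[OF w(1)] w U
      by blast
  qed
  \<comment> \<open>Twice this bound plus \<open>card U \<le> card V - 2 * card M\<close> gives the
    claim.\<close>
  then have "card U \<le> card M"
    using pq fin by (intro card_inj_on_le) auto
  moreover have "card U \<le> card (V - \<Union>M)" using U fin by (intro card_mono) auto
  moreover have "\<Union>M \<subseteq> V" using simple_graph_subset[OF G M] by (auto simp: simple_graph_def)
  then have "card (V - \<Union>M) = card V - 2 * card M" "2 * card M \<le> card V"
    using card_Union_matching[OF G M] fin
    by (auto simp: card_Diff_subset finite_subset card_mono dest: card_mono[of V])
  ultimately show ?thesis by linarith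
next
  case False
  then obtain w\<^sub>0 a b where w0: "w\<^sub>0 \<in> U" "label E M w\<^sub>0 a b \<noteq> 0" by blast
  \<comment> \<open>Swapping the ends negates the label, so it may be taken positive; then all of
    \<open>U\<close> is adjacent to \<open>u\<close>.\<close>
  have "label E M w\<^sub>0 b a = - label E M w\<^sub>0 a b" by (simp add: label_def insert_commute)
  with w0 have "label E M w\<^sub>0 a b > 0 \<or> label E M w\<^sub>0 b a > 0" by linarith
  then obtain u v where uv: "label E M w\<^sub>0 u v > 0" by blast
  then have M': "{u, v} \<in> M" by (auto simp: label_def split: if_splits)
  have "{w, u} \<in> E" if "w \<in> U" for w
    using same[OF w0(1) that] uv by (auto simp: label_def adj_def split: if_splits)
  \<comment> \<open>The matched vertex \<open>v\<close> is outside \<open>U\<close>, so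
    \<open>{u, v}\<close> is a further edge at \<open>u\<close>. It absorbs the summand 1 of the
    degree bound: \<open>card U + 1 \<le> degree E u\<close>.\<close>
  then have "(\<lambda>w. {w, u}) ` U \<subseteq> {e \<in> E. u \<in> e} - {{u, v}}"
    using U M' by (auto simp: doubleton_eq_iff)
  moreover have "finite {e \<in> E. u \<in> e}" using simple_graph_finite(2)[OF G] by simp
  moreover have "inj_on (\<lambda>w. {w, u}) U" by (auto simp: inj_on_def doubleton_eq_iff)
  ultimately have "card U \<le> card ({e \<in> E. u \<in> e} - {{u, v}})"
    by (intro card_inj_on_le) auto
  moreover have "{u, v} \<in> {e \<in> E. u \<in> e}" using M' M by (auto simp: matching_def)
  then have "Suc (card ({e \<in> E. u \<in> e} - {{u, v}})) = degree E u"
    using \<open>finite {e \<in> E. u \<in> e}\<close> unfolding degree_def by (metis card.remove)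
  moreover have "u \<in> V" using M' simple_graph_subset[OF G M] by (auto simp: simple_graph_def)
  ultimately show ?thesis using deg[of u] by linarith
qed

section \<open>Averaging and the final bisection\<close>

lemma bisection_cut_sign:
  assumes G: "simple_graph V E"
    and deg: "\<And>v. v \<in> V \<Longrightarrow> 3 * degree E v \<le> card V + 3"
    and pos: "\<And>v. v \<in> V \<Longrightarrow> degree E v \<noteq> 0"
  shows "\<exists>B\<subseteq>V. \<bar>\<Sum>x\<in>V. side B x\<bar> \<le> 1 \<and> int (card V) \<le> 3 * (\<Sum>e\<in>E. cut_sign B e)"
proof -
  have fin: "finite V" "finite E" by (rule simple_graph_finite[OF G])+
  obtain M where M: "matching E M" and max: "\<And>N. matching E N \<Longrightarrow> card N \<le> card M"
    using maximum_matching_exists[OF G] by blast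
  define A W where "A = \<Union>M" and "W = V - A"
  let ?T = "transversals M"
  have AV: "A \<subseteq> V" using simple_graph_subset[OF G M] by (auto simp: simple_graph_def A_def)
  have finW: "finite W" "finite A" using fin AV by (auto simp: W_def intro: finite_subset)
  \<comment> \<open>The pairs depend on the labels alone, so the same pairs serve every transversal;
    only their orientation will depend on \<open>C\<close>.\<close>
  obtain I j U where P: "W = I \<union> j ` I \<union> U" "inj_on j I" "I \<inter> j ` I = {}" "(I \<union> j ` I) \<inter> U = {}"
    and I: "\<And>w. w \<in> I \<Longrightarrow> label E M w \<noteq> label E M (j w)"
    and U: "\<And>w w'. w \<in> U \<Longrightarrow> w' \<in> U \<Longrightarrow> label E M w = label E M w'"
    using distinct_label_pairing[OF finW(1), of "label E M"] by metis
  have "3 * card U \<le> card V"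
    using label_class_bound[OF G M max deg pos _ U] P(1) unfolding W_def A_def by blast
  moreover have "card V = 2 * card M + (2 * card I + card U)"
  proof -
    have f: "finite I" "finite U" using finW P(1) by auto
    have "card W = card (I \<union> j ` I) + card U"
      unfolding P(1) using f P(4) by (intro card_Un_disjoint) auto
    also have "card (I \<union> j ` I) = card I + card I"
      using f P(2,3) by (simp add: card_Un_disjoint card_image)
    finally have "card W = 2 * card I + card U" by simp
    moreover have "card V = card A + card W"
      using fin AV finW unfolding W_def by (metis card_Diff_subset card_mono le_add_diff_inverse)
    moreover have "card A = 2 * card M" unfolding A_def by (rule card_Union_matching[OF G M])
    ultimately show ?thesis by simp
  qed
  \<comment> \<open>At most a third of the vertices lie in \<open>U\<close>, so the
    \<open>2 * (card M + card I)\<close> others are at least two thirds.\<close>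
  ultimately have count: "card V \<le> 3 * (card M + card I)" by simp
  \<comment> \<open>\<open>F C\<close> is the sign sum guaranteed by \<open>C\<close> once the pairs
    are oriented optimally. Edges of \<open>M\<close> and pairs each add at least 1 to its average;
    the other edges inside \<open>A\<close> average to 0.\<close>
  define F where "F C = (\<Sum>e\<in>{e \<in> E. e \<subseteq> A}. cut_sign C e)
    + (\<Sum>w\<in>I. \<bar>imbalance E A C w - imbalance E A C (j w)\<bar>)" for C
  have "(\<Sum>C\<in>?T. int (card M + card I)) \<le> (\<Sum>C\<in>?T. F C)"
  proof -
    have "M = {e \<in> {e \<in> E. e \<subseteq> A}. e \<in> M}" using M by (auto simp: A_def matching_def)
    then have "(\<Sum>e\<in>{e \<in> E. e \<subseteq> A}. if e \<in> M then int (card ?T) else 0) = (\<Sum>e\<in>M. int (card ?T))"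
      using fin by (simp add: sum.inter_filter[symmetric])
    then have "int (card M) * int (card ?T)
        = (\<Sum>e\<in>{e \<in> E. e \<subseteq> A}. if e \<in> M then int (card ?T) else 0)"
      by simp
    also have "\<dots> = (\<Sum>e\<in>{e \<in> E. e \<subseteq> A}. \<Sum>C\<in>?T. cut_sign C e)"
      using sum_cut_sign_transversals[OF G M] by (intro sum.cong) (auto simp: A_def)
    also have "\<dots> = (\<Sum>C\<in>?T. \<Sum>e\<in>{e \<in> E. e \<subseteq> A}. cut_sign C e)" by (rule sum.swap)
    finally have 1: "int (card M) * int (card ?T) = \<dots>" .
    have "int (card I) * int (card ?T) = (\<Sum>w\<in>I. int (card ?T))" by simp
    also have "\<dots> \<le> (\<Sum>w\<in>I. \<Sum>C\<in>?T. \<bar>imbalance E A C w - imbalance E A C (j w)\<bar>)"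
      using sum_imbalance_diff[OF G M I] by (intro sum_mono) (auto simp: A_def)
    also have "\<dots> = (\<Sum>C\<in>?T. \<Sum>w\<in>I. \<bar>imbalance E A C w - imbalance E A C (j w)\<bar>)"
      by (rule sum.swap)
    finally show ?thesis using 1 by (simp add: F_def sum.distrib algebra_simps)
  qed
  \<comment> \<open>Some transversal does at least as well as the average.\<close>
  then obtain C where C: "C \<in> ?T" "int (card M + card I) \<le> F C"
    using sum_strict_mono[OF transversals_finite[OF G M] transversals_nonempty[OF G M], 
        of F "\<lambda>_. int (card M + card I)"] by (meson not_le)
  obtain D where D: "D \<subseteq> W" "\<bar>\<Sum>w\<in>W. side D w\<bar> \<le> 1"
    "(\<Sum>w\<in>I. \<bar>imbalance E A C w - imbalance E A C (j w)\<bar>) \<le> - (\<Sum>w\<in>W. side D w * imbalance E A C w)"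
    using balanced_pairing[OF finW(1) P, of "imbalance E A C"] by blast
  have CA: "C \<subseteq> A" using C by (auto simp: transversals_def A_def)
  have sA: "side (C \<union> D) x = side C x" if "x \<in> A" for x
    using that D(1) by (auto simp: side_def W_def)
  have sW: "side (C \<union> D) x = side D x" if "x \<in> W" for x
    using that CA by (auto simp: side_def W_def)
  \<comment> \<open>Imbalances look only at \<open>A\<close>, so placing \<open>W\<close> by
    \<open>D\<close> does not disturb them.\<close>
  have imb: "imbalance E A (C \<union> D) w = imbalance E A C w" for w
    by (simp add: imbalance_def sA)
  have cut: "cut_sign (C \<union> D) e = cut_sign C e" if "e \<subseteq> A" for e
    unfolding cut_sign_def using that sA by (metis (no_types, lifting) prod.cong subsetD)
  have "(\<Sum>e\<in>E. cut_sign (C \<union> D) e) = (\<Sum>e\<in>{e \<in> E. e \<subseteq> A}. cut_sign C e)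
      - (\<Sum>w\<in>W. side D w * imbalance E A C w)"
    using sum_cut_sign_split[OF G AV, of "C \<union> D"] maximum_matching_independent[OF G M max]
    by (simp add: cut imb sW flip: W_def A_def)
  then have "F C \<le> (\<Sum>e\<in>E. cut_sign (C \<union> D) e)" using D(3) by (simp add: F_def)
  then have "int (card V) \<le> 3 * (\<Sum>e\<in>E. cut_sign (C \<union> D) e)" using C(2) count by simp
  \<comment> \<open>The matched part is exactly balanced, so the discrepancy is that of
    \<open>W\<close>.\<close>
  moreover have "(\<Sum>x\<in>V. side (C \<union> D) x) = (\<Sum>w\<in>W. side D w)"
  proof -
    have "(\<Sum>x\<in>V. side (C \<union> D) x) = (\<Sum>x\<in>W. side (C \<union> D) x) + (\<Sum>x\<in>A. side (C \<union> D) x)"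
      unfolding W_def using sum.subset_diff[OF AV fin(1)] .
    then show ?thesis
      using transversal_balanced[OF G M C(1)] by (simp add: sA sW flip: A_def)
  qed
  ultimately show ?thesis using D CA AV by (intro exI[of _ "C \<union> D"]) (auto simp: W_def)
qed

theorem corollary1p5:
  fixes V :: "'a set" and E :: "'a set set" and n m :: nat
  assumes "simple_graph V E"
    and "card V = n"
    and "card E = m"
    and "real (max_degree V E) \<le> real n / 3 + 1"
    and "\<forall>v\<in>V. \<not> isolated_vertex E v"
  shows "\<exists>V\<^sub>1 V\<^sub>2. bisection V V\<^sub>1 V\<^sub>2 \<and>
           real (edges_between E V\<^sub>1 V\<^sub>2) \<ge> real m / 2 + real n / 6"
proof -
  have fin: "finite V" by (rule simple_graph_finite[OF assms(1)])
  have deg: "3 * degree E v \<le> card V + 3" if "v \<in> V" for v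
  proof -
    have "degree E v \<le> max_degree V E" unfolding max_degree_def using fin that by simp
    then have "3 * real (degree E v) \<le> real n + 3" using assms(4) by linarith
    then show ?thesis using assms(2) by linarith
  qed
  obtain B where B: "B \<subseteq> V" "\<bar>\<Sum>x\<in>V. side B x\<bar> \<le> 1" "int n \<le> 3 * (\<Sum>e\<in>E. cut_sign B e)"
    using bisection_cut_sign[OF assms(1) deg] assms(2,5) by (auto simp: isolated_vertex_def)
  \<comment> \<open>The sum of the signs is the difference of the sizes of the two parts.\<close>
  have "(\<Sum>x\<in>V. side B x) = (\<Sum>x\<in>V - B. side B x) + (\<Sum>x\<in>B. side B x)"
    by (rule sum.subset_diff[OF B(1) fin])
  also have "\<dots> = int (card B) - int (card (V - B))" by (simp add: side_def)
  finally have "bisection V B (V - B)" using B(1,2) by (auto simp: bisection_def)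
  moreover have "int n \<le> 3 * (2 * int (edges_between E B (V - B)) - int m)"
    using B(3) sum_cut_sign[OF assms(1) B(1)] assms(3) by simp
  then have "real m / 2 + real n / 6 \<le> real (edges_between E B (V - B))" by simp
  ultimately show ?thesis by blast
qed

end
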